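(* Let $\Omega\subseteq\mathbb R^n$ be an open set satisfying the cone condition $(h_1)$ stated in the context. Let $r\in\mathbb N$ and let $p,q$ be real numbers with $1\le p\le q<+\infty$, $q\ge \frac nr$, and moreover $q>\frac nr$ if $\frac nr=p>1$. Let $s\in\mathbb R$ with $s\le p$ and let $g\in\widetilde{\mathcal M}^{q,\frac sp}(\Omega)$. Let $C$ be the constant of the multiplication bound recalled in the context, let $\tau[g]$ be a modulus of continuity of $g$ in $\widetilde{\mathcal M}^{q,\frac sp}(\Omega)$, and let $k\mapsto r[g](k)$ be the function defined in the context. Then for every $k\in\mathbb R_+$, $$\|gu\|_{L^p(\Omega)}\le C\,\tau[g]\!\left(\tfrac1k\right)\|u\|_{W^{r,p}(\Omega)}+r[g](k)\,\|u\|_{L^p(\Omega)}\qquad\text{for all }u\in W^{r,p}(\Omega).$$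
   Context: Functions are complex valued, $\mathbb R_+=\,]0,+\infty[$, $B_\rho(x)$ is the open ball in $\mathbb R^n$ of center $x$ and radius $\rho$, and $d>0$ is a fixed real number. $W^{r,p}(\Omega)$ is the usual Sobolev space. Cones: for $x\in\mathbb R^n$, an open infinite cone with vertex $x$ is a set $\{x+\lambda(y-x):\lambda>0,\ |y-z|<a\}$ with $a>0$, $z\in\mathbb R^n$, $|z-x|>a$. $C_\theta(x)$ denotes an open infinite cone with vertex $x$ and opening $\theta$, and $C_\theta(x,h)=C_\theta(x)\cap B_h(x)$. Condition $(h_1)$: there exists $\theta\in\,]0,\pi/2[$ such that for every $x\in\Omega$ there is a cone $C_\theta(x)$ with $\overline{C_\theta(x,\rho)}\subset\Omega$ for all $\rho\in\,]0,d]$. Spaces: $\Omega_\rho(x)=B_\rho(x)\cap\Omega$. For $1\le p<+\infty$ and $\sigma\in\mathbb R$, $\mathcal M^{p,\sigma}(\Omega)$ is the space of $g\in L^p_{loc}(\overline\Omega)$ (i.e. $g\in L^p(\Omega\cap B)$ for every ball $B$) such that $$\|g\|_{\mathcal M^{p,\sigma}(\Omega)}=\sup_{x\in\Omega,\ \rho\in]0,d]}\rho^{\sigma-n/p}\|g\|_{L^p(\Omega_\rho(x))}<+\infty,$$ with this norm. $\widetilde{\mathcal M}^{p,\sigma}(\Omega)$ is the closure of $L^\infty(\Omega)$ in $\mathcal M^{p,\sigma}(\Omega)$ (for $\sigma\ge0$ one has $L^\infty(\Omega)\subset \mathcal M^{p,\sigma}(\Omega)$; in general, the closure of $L^\infty(\Omega)\cap\mathcal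 M^{p,\sigma}(\Omega)$). The constant $C$: if $\Omega\subseteq\mathbb R^n$ is an open set satisfying $(h_1)$, $r\in\mathbb N$, $p,q$ are real numbers with $1\le p\le q<+\infty$, $q\ge\frac nr$, and $q>\frac nr$ if $\frac nr=p>1$, and $s\in\mathbb R$ with $s\le p$, then it is known from earlier work that there is a constant $C$, independent of $g$ and $u$, such that $gu\in L^p(\Omega)$ and $\|gu\|_{L^p(\Omega)}\le C\|g\|_{\mathcal M^{q,\frac sp}(\Omega)}\|u\|_{W^{r,p}(\Omega)}$ for all $g\in\mathcal M^{q,\frac sp}(\Omega)$ and $u\in W^{r,p}(\Omega)$; $C$ denotes such a constant. Modulus of continuity: let $\Sigma(\Omega)$ be the $\sigma$-algebra of Lebesgue measurable subsets of $\Omega$ and $\chi_E$ the characteristic function of $E$. For $t\in\mathbb R_+$ put $$\tau^q_{s/p}[g](t)=\sup\Big\{\|g\chi_E\|_{\mathcal M^{q,\frac sp}(\Omega)}:\ E\in\Sigma(\Omega),\ \sup_{x\in\Omega}|E\cap B_d(x)|\le t\Big\}.$$ A modulus of continuity of $g$ in $\widetilde{\mathcal M}^{q,\frac sp}(\Omega)$ is a function $\tau[g]:\mathbb R_+\to\mathbb R_+$ with $\tau^q_{s/p}[g](t)\le\tau[g](t)$ for all $t\in\mathbb R_+$ and $\lim_{t\to0}\tau[g](t)=0$. The function $r[g]$: for $a\in\mathbb R_+$ let $\Omega_a(g)=\{x\in\Omega:|g(x)|\ge a\}$. For each $k\in\mathbb R_+$, $r[g](k)=r_k\in\mathbb R_+$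 denotes a (chosen) number such that $\sup_{x\in\Omega}|\Omega_{r_k}(g)\cap B_d(x)|\le\frac1k$. *)

theory Defs
  imports "HOL-Analysis.Analysis"
begin

text \<open>
  A function on \<open>\<Omega> \<subseteq> \<real>\<^sup>n\<close> is represented by a total function on \<open>real ^ 'n\<close> of which only the
  values on \<open>\<Omega>\<close> matter. All spaces below consist of functions rather than of classes modulo
  equality almost everywhere, and all norms depend only on the class. The number \<open>d > 0\<close>
  is a parameter throughout.
\<close>

subsection \<open>Lebesgue spaces\<close>

definition Lp_space :: "(real ^ 'n) set \<Rightarrow> real \<Rightarrow> (real ^ 'n \<Rightarrow> complex) set" where
  "Lp_space S p = {f. f \<in> borel_measurable (lebesgue_on S) \<and>
                      integrable (lebesgue_on S) (\<lambda>x. norm (f x) powr p)}"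

text \<open>Only meaningful for \<open>f \<in> Lp_space S p\<close> (a divergent integral has the value \<open>0\<close>).\<close>

definition Lp_norm :: "(real ^ 'n) set \<Rightarrow> real \<Rightarrow> (real ^ 'n \<Rightarrow> complex) \<Rightarrow> real" where
  "Lp_norm S p f = (\<integral>x. norm (f x) powr p \<partial>lebesgue_on S) powr (1 / p)"

definition Linf_space :: "(real ^ 'n) set \<Rightarrow> (real ^ 'n \<Rightarrow> complex) set" where
  "Linf_space S = {f. f \<in> borel_measurable (lebesgue_on S) \<and>
                      (\<exists>c. AE x in lebesgue_on S. norm (f x) \<le> c)}"

subsection \<open>Sobolev spaces\<close>

definition partial_deriv :: "'n::finite \<Rightarrow> (real ^ 'n \<Rightarrow> complex) \<Rightarrow> real ^ 'n \<Rightarrow> complex" where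
  "partial_deriv i f x = frechet_derivative f (at x) (axis i 1)"

definition iter_partial :: "'n::finite list \<Rightarrow> (real ^ 'n \<Rightarrow> complex) \<Rightarrow> real ^ 'n \<Rightarrow> complex" where
  "iter_partial js f = foldr partial_deriv js f"

text \<open>
  A function is \<open>C\<^sup>\<infinity>\<close> iff all iterated partial derivatives exist and are (totally) differentiable.
\<close>

definition test_functions :: "(real ^ 'n::finite) set \<Rightarrow> (real ^ 'n \<Rightarrow> complex) set" where
  "test_functions \<Omega> = {\<phi>. (\<forall>js x. iter_partial js \<phi> differentiable (at x)) \<and>
                          compact (closure {x. \<phi> x \<noteq> 0}) \<and> closure {x. \<phi> x \<noteq> 0} \<subseteq> \<Omega>}"

definition L1_loc :: "(real ^ 'n) set \<Rightarrow> (real ^ 'n \<Rightarrow> complex) set" where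
  "L1_loc \<Omega> = {f. \<forall>K. compact K \<and> K \<subseteq> \<Omega> \<longrightarrow> set_integrable lebesgue K f}"

text \<open>
  Multi-indices are functions \<open>\<alpha> :: 'n \<Rightarrow> nat\<close>. The derivative \<open>D\<^sup>\<alpha> \<phi>\<close> of a test function is
  \<open>iter_partial js \<phi>\<close> for any list \<open>js\<close> of directions in which each \<open>i\<close> occurs \<open>\<alpha> i\<close> times;
  since \<open>\<phi>\<close> is smooth, the order of the directions is irrelevant.
\<close>

definition has_weak_deriv ::
  "(real ^ 'n::finite) set \<Rightarrow> ('n \<Rightarrow> nat) \<Rightarrow> (real ^ 'n \<Rightarrow> complex) \<Rightarrow> (real ^ 'n \<Rightarrow> complex) \<Rightarrow> bool" where
  "has_weak_deriv \<Omega> \<alpha> u v \<longleftrightarrow> u \<in> L1_loc \<Omega> \<and> v \<in> L1_loc \<Omega> \<and>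
     (\<forall>\<phi>\<in>test_functions \<Omega>. \<forall>js. count_list js = \<alpha> \<longrightarrow>
        (\<integral>x. u x * iter_partial js \<phi> x \<partial>lebesgue_on \<Omega>) =
        (- 1) ^ (\<Sum>i\<in>UNIV. \<alpha> i) * (\<integral>x. v x * \<phi> x \<partial>lebesgue_on \<Omega>))"

text \<open>For open \<open>\<Omega>\<close> the choice is unique up to equality almost everywhere on \<open>\<Omega>\<close>.\<close>

definition weak_deriv ::
  "(real ^ 'n::finite) set \<Rightarrow> ('n \<Rightarrow> nat) \<Rightarrow> (real ^ 'n \<Rightarrow> complex) \<Rightarrow> real ^ 'n \<Rightarrow> complex" where
  "weak_deriv \<Omega> \<alpha> u = (SOME v. has_weak_deriv \<Omega> \<alpha> u v)"

definition sobolev_space :: "(real ^ 'n::finite) set \<Rightarrow> nat \<Rightarrow> real \<Rightarrow> (real ^ 'n \<Rightarrow> complex) set" where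
  "sobolev_space \<Omega> r p = {u \<in> Lp_space \<Omega> p.
     \<forall>\<alpha>. (\<Sum>i\<in>UNIV. \<alpha> i) \<le> r \<longrightarrow> (\<exists>v\<in>Lp_space \<Omega> p. has_weak_deriv \<Omega> \<alpha> u v)}"

definition sobolev_norm ::
  "(real ^ 'n::finite) set \<Rightarrow> nat \<Rightarrow> real \<Rightarrow> (real ^ 'n \<Rightarrow> complex) \<Rightarrow> real" where
  "sobolev_norm \<Omega> r p u =
     (\<Sum>\<alpha> | (\<Sum>i\<in>UNIV. \<alpha> i) \<le> r. Lp_norm \<Omega> p (weak_deriv \<Omega> \<alpha> u) powr p) powr (1 / p)"

subsection \<open>The cone condition\<close>

definition infinite_cone :: "real ^ 'n \<Rightarrow> real ^ 'n \<Rightarrow> real \<Rightarrow> (real ^ 'n) set" where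
  "infinite_cone x z a = {x + l *\<^sub>R (y - x) | l y. l > 0 \<and> dist y z < a}"

text \<open>
  The opening is the angle between the axis and the generators of the cone, so that it ranges
  over \<open>]0, \<pi>/2[\<close>. Taking the full aperture instead gives an equivalent condition \<open>cone_cond\<close>.
\<close>

definition is_cone_with_opening :: "real \<Rightarrow> real ^ 'n \<Rightarrow> (real ^ 'n) set \<Rightarrow> bool" where
  "is_cone_with_opening \<theta> x K \<longleftrightarrow>
     (\<exists>z a. a > 0 \<and> dist z x > a \<and> \<theta> = arcsin (a / dist z x) \<and> K = infinite_cone x z a)"

definition cone_cond :: "real \<Rightarrow> (real ^ 'n) set \<Rightarrow> bool" where
  "cone_cond d \<Omega> \<longleftrightarrow> (\<exists>\<theta>. 0 < \<theta> \<and> \<theta> < pi / 2 \<and>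
     (\<forall>x\<in>\<Omega>. \<exists>K. is_cone_with_opening \<theta> x K \<and>
        (\<forall>\<rho>. 0 < \<rho> \<and> \<rho> \<le> d \<longrightarrow> closure (K \<inter> ball x \<rho>) \<subseteq> \<Omega>)))"

subsection \<open>Morrey type spaces\<close>

definition Lp_loc_closure :: "(real ^ 'n) set \<Rightarrow> real \<Rightarrow> (real ^ 'n \<Rightarrow> complex) set" where
  "Lp_loc_closure \<Omega> p = {g. \<forall>x \<rho>. g \<in> Lp_space (\<Omega> \<inter> ball x \<rho>) p}"

text \<open>The norm with values in \<open>[0, \<infinity>]\<close>, for \<open>g \<in> Lp_loc_closure \<Omega> p\<close>.\<close>

definition morrey_enorm ::
  "real \<Rightarrow> (real ^ 'n::finite) set \<Rightarrow> real \<Rightarrow> real \<Rightarrow> (real ^ 'n \<Rightarrow> complex) \<Rightarrow> ennreal" where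
  "morrey_enorm d \<Omega> p \<sigma> g = (SUP x\<in>\<Omega>. SUP \<rho>\<in>{0<..d}.
     ennreal (\<rho> powr (\<sigma> - real CARD('n) / p) * Lp_norm (ball x \<rho> \<inter> \<Omega>) p g))"

definition morrey_space ::
  "real \<Rightarrow> (real ^ 'n::finite) set \<Rightarrow> real \<Rightarrow> real \<Rightarrow> (real ^ 'n \<Rightarrow> complex) set" where
  "morrey_space d \<Omega> p \<sigma> = {g \<in> Lp_loc_closure \<Omega> p. morrey_enorm d \<Omega> p \<sigma> g < \<infinity>}"

definition morrey_norm ::
  "real \<Rightarrow> (real ^ 'n::finite) set \<Rightarrow> real \<Rightarrow> real \<Rightarrow> (real ^ 'n \<Rightarrow> complex) \<Rightarrow> real" where
  "morrey_norm d \<Omega> p \<sigma> g = enn2real (morrey_enorm d \<Omega> p \<sigma> g)"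

definition morrey_tilde_space ::
  "real \<Rightarrow> (real ^ 'n::finite) set \<Rightarrow> real \<Rightarrow> real \<Rightarrow> (real ^ 'n \<Rightarrow> complex) set" where
  "morrey_tilde_space d \<Omega> p \<sigma> = {g \<in> morrey_space d \<Omega> p \<sigma>.
     \<forall>\<epsilon>>0. \<exists>h \<in> Linf_space \<Omega> \<inter> morrey_space d \<Omega> p \<sigma>. morrey_norm d \<Omega> p \<sigma> (\<lambda>x. g x - h x) < \<epsilon>}"

subsection \<open>The multiplication constant, moduli of continuity and the function \<open>r[g]\<close>\<close>

text \<open>
  \<open>C \<ge> 0\<close> is not implied by the bound: for \<open>s < 0\<close> the Morrey space consists only of functions
  vanishing almost everywhere on \<open>\<Omega>\<close>.
\<close>

definition is_mult_constant ::
  "real \<Rightarrow> (real ^ 'n::finite) set \<Rightarrow> nat \<Rightarrow> real \<Rightarrow> real \<Rightarrow> real \<Rightarrow> real \<Rightarrow> bool" where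
  "is_mult_constant d \<Omega> r p q s C \<longleftrightarrow> C \<ge> 0 \<and>
     (\<forall>g\<in>morrey_space d \<Omega> q (s / p). \<forall>u\<in>sobolev_space \<Omega> r p.
        (\<lambda>x. g x * u x) \<in> Lp_space \<Omega> p \<and>
        Lp_norm \<Omega> p (\<lambda>x. g x * u x) \<le> C * morrey_norm d \<Omega> q (s / p) g * sobolev_norm \<Omega> r p u)"

definition morrey_tau ::
  "real \<Rightarrow> (real ^ 'n::finite) set \<Rightarrow> real \<Rightarrow> real \<Rightarrow> (real ^ 'n \<Rightarrow> complex) \<Rightarrow> real \<Rightarrow> ennreal" where
  "morrey_tau d \<Omega> q \<sigma> g t =
     (SUP E\<in>{E \<in> sets lebesgue. E \<subseteq> \<Omega> \<and>
              (SUP x\<in>\<Omega>. emeasure lebesgue (E \<inter> ball x d)) \<le> ennreal t}.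
        morrey_enorm d \<Omega> q \<sigma> (\<lambda>x. g x * indicator E x))"

definition is_modulus_of_continuity ::
  "real \<Rightarrow> (real ^ 'n::finite) set \<Rightarrow> real \<Rightarrow> real \<Rightarrow> (real ^ 'n \<Rightarrow> complex) \<Rightarrow> (real \<Rightarrow> real) \<Rightarrow> bool" where
  "is_modulus_of_continuity d \<Omega> q \<sigma> g \<tau> \<longleftrightarrow>
     (\<forall>t>0. \<tau> t > 0 \<and> morrey_tau d \<Omega> q \<sigma> g t \<le> ennreal (\<tau> t)) \<and>
     (\<tau> \<longlongrightarrow> 0) (at_right 0)"

definition superlevel_set ::
  "(real ^ 'n) set \<Rightarrow> (real ^ 'n \<Rightarrow> complex) \<Rightarrow> real \<Rightarrow> (real ^ 'n) set" where
  "superlevel_set \<Omega> g a = {x \<in> \<Omega>. norm (g x) \<ge> a}"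

definition is_level_function ::
  "real \<Rightarrow> (real ^ 'n) set \<Rightarrow> (real ^ 'n \<Rightarrow> complex) \<Rightarrow> (real \<Rightarrow> real) \<Rightarrow> bool" where
  "is_level_function d \<Omega> g rg \<longleftrightarrow> (\<forall>k>0. rg k > 0 \<and>
     (SUP x\<in>\<Omega>. emeasure lebesgue (superlevel_set \<Omega> g (rg k) \<inter> ball x d)) \<le> ennreal (1 / k))"

end

theory Submission
  imports Defs
begin

text \<open>
  Split \<open>g\<close> along its superlevel set \<open>E = \<Omega>\<^bsub>r[g](k)\<^esub>(g)\<close>. The choice of \<open>r[g](k)\<close> makes \<open>E\<close> admissible
  in the supremum defining \<open>\<tau>[g](1/k)\<close>, so the multiplication bound controls \<open>g\<chi>\<^sub>E u\<close>, while off
  \<open>E\<close> the factor \<open>g\<close> is bounded by \<open>r[g](k)\<close>. The two parts are combined by Minkowski's inequality.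
\<close>

lemma convex_on_powr_nonneg:
  fixes p :: real
  assumes p: "1 \<le> p"
  shows "convex_on {0..} (\<lambda>x. x powr p)"
proof (rule convex_onI)
  fix t x y :: real
  assume t: "0 < t" "t < 1" and xy: "x \<in> {0..}" "y \<in> {0..}"
  have shrink: "(c * z) powr p \<le> c * z powr p" if "0 \<le> c" "c \<le> 1" "0 \<le> z" for c z :: real
  proof -
    have "c powr p \<le> c"
      using that powr_mono'[OF p that(1,2)] by simp
    then show ?thesis
      using that by (simp add: powr_mult mult_right_mono)
  qed
  show "((1 - t) *\<^sub>R x + t *\<^sub>R y) powr p \<le> (1 - t) * x powr p + t * y powr p"
  proof (cases "x = 0 \<or> y = 0")
    case True
    then show ?thesis
      using shrink[of t y] shrink[of "1 - t" x] t xy p by auto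
  next
    case False
    then show ?thesis
      using convex_onD[OF powr_convex[OF p], of t x y] t xy by simp
  qed
qed simp

lemma powr_add_le_weighted:
  fixes x y a b p :: real
  assumes p: "1 \<le> p" and a: "0 < a" and b: "0 < b" and x: "0 \<le> x" and y: "0 \<le> y"
  shows "(x + y) powr p \<le> (a + b) powr p * (a / (a + b) * (x powr p / a powr p) + b / (a + b) * (y powr p / b powr p))"
proof -
  have ab: "0 < a + b" using a b by simp
  define t where "t = b / (a + b)"
  have t: "0 \<le> t" "t \<le> 1" "1 - t = a / (a + b)"
    using a b ab by (auto simp: t_def field_simps)
  have "((1 - t) *\<^sub>R (x / a) + t *\<^sub>R (y / b)) powr p
      \<le> (1 - t) * ((x / a) powr p) + t * ((y / b) powr p)"
    by (rule convex_onD[OF convex_on_powr_nonneg]) (use p a b x y t in auto)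
  moreover have "(1 - t) *\<^sub>R (x / a) + t *\<^sub>R (y / b) = (x + y) / (a + b)"
    unfolding t(3) unfolding t_def using a b by (simp add: add_divide_distrib)
  ultimately have "(x + y) powr p / (a + b) powr p
      \<le> a / (a + b) * (x powr p / a powr p) + b / (a + b) * (y powr p / b powr p)"
    using t(3) a b x y by (simp add: powr_divide t_def)
  then show ?thesis
    using ab by (simp add: divide_le_eq mult.commute)
qed

lemma Lp_norm_le_iff:
  assumes "0 < p" "0 \<le> a"
  shows "Lp_norm S p f \<le> a \<longleftrightarrow> (\<integral>x. norm (f x) powr p \<partial>lebesgue_on S) \<le> a powr p"
proof -
  let ?I = "\<integral>x. norm (f x) powr p \<partial>lebesgue_on S"
  have I: "0 \<le> ?I" by simp
  have "?I powr (1 / p) \<le> a \<longleftrightarrow> (?I powr (1 / p)) powr p \<le> a powr p"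
    using assms powr_mono2[of p "?I powr (1 / p)" a] powr_less_mono2[of p a "?I powr (1 / p)"]
    by (auto simp: not_less[symmetric])
  then show ?thesis
    using assms I by (simp add: Lp_norm_def powr_powr)
qed

lemma Lp_norm_nonneg: "0 \<le> Lp_norm S p f"
  by (simp add: Lp_norm_def)

lemma Lp_norm_triangle:
  assumes p: "1 \<le> p" and f: "f \<in> Lp_space S p" and h: "h \<in> Lp_space S p"
  shows "Lp_norm S p (\<lambda>x. f x + h x) \<le> Lp_norm S p f + Lp_norm S p h"
proof (rule field_le_epsilon)
  fix e :: real assume e: "0 < e"
  define a where "a = Lp_norm S p f + e / 2"
  define b where "b = Lp_norm S p h + e / 2"
  have a: "0 < a" and b: "0 < b"
    using e Lp_norm_nonneg[of S p f] Lp_norm_nonneg[of S p h] by (auto simp: a_def b_def)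
  let ?M = "lebesgue_on S"
  let ?F = "\<lambda>x. norm (f x) powr p" and ?H = "\<lambda>x. norm (h x) powr p"
  let ?G = "\<lambda>x. (a + b) powr p * (a / (a + b) * (?F x / a powr p) + b / (a + b) * (?H x / b powr p))"
  have iF: "integrable ?M ?F" and iH: "integrable ?M ?H"
    using f h by (auto simp: Lp_space_def)
  have "(\<integral>x. ?F x \<partial>?M) \<le> a powr p" "(\<integral>x. ?H x \<partial>?M) \<le> b powr p"
    using Lp_norm_le_iff[of p a S f] Lp_norm_le_iff[of p b S h] p a b e
    by (auto simp: a_def b_def)
  then have FH: "(\<integral>x. ?F x \<partial>?M) / a powr p \<le> 1" "(\<integral>x. ?H x \<partial>?M) / b powr p \<le> 1"
    using a b by simp_all
  have "(\<integral>x. norm (f x + h x) powr p \<partial>?M) \<le> (\<integral>x. ?G x \<partial>?M)"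
  proof (rule integral_mono')
    show "integrable ?M ?G" using iF iH by simp
    fix x
    have "norm (f x + h x) powr p \<le> (norm (f x) + norm (h x)) powr p"
      using p by (intro powr_mono2 norm_triangle_ineq) auto
    also have "\<dots> \<le> ?G x" using p a b by (intro powr_add_le_weighted) auto
    finally show "norm (f x + h x) powr p \<le> ?G x" .
  qed (use a b in simp)
  also have "\<dots> = (a + b) powr p *
      (a / (a + b) * ((\<integral>x. ?F x \<partial>?M) / a powr p) + b / (a + b) * ((\<integral>x. ?H x \<partial>?M) / b powr p))"
    using iF iH by simp
  also have "\<dots> \<le> (a + b) powr p * (a / (a + b) * 1 + b / (a + b) * 1)"
    using FH a b by (intro mult_left_mono add_mono) auto
  also have "\<dots> = (a + b) powr p"
    using a b by (simp add: add_divide_distrib[symmetric])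
  finally have "Lp_norm S p (\<lambda>x. f x + h x) \<le> a + b"
    using p a b by (simp add: Lp_norm_le_iff)
  then show "Lp_norm S p (\<lambda>x. f x + h x) \<le> Lp_norm S p f + Lp_norm S p h + e"
    by (simp add: a_def b_def)
qed

lemma Lp_space_dominated:
  assumes "0 < p" "f \<in> borel_measurable (lebesgue_on S)" "h \<in> Lp_space S p"
    and "\<And>x. x \<in> S \<Longrightarrow> norm (f x) \<le> c * norm (h x)"
  shows "f \<in> Lp_space S p"
proof -
  have "c * norm (h x) \<le> \<bar>c\<bar> * norm (h x)" for x by (intro mult_right_mono) auto
  then have le: "norm (f x) \<le> \<bar>c\<bar> * norm (h x)" if "x \<in> S" for x
    using assms(4)[OF that] order_trans by blast
  have "integrable (lebesgue_on S) (\<lambda>x. norm (f x) powr p)"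
  proof (rule Bochner_Integration.integrable_bound)
    show "integrable (lebesgue_on S) (\<lambda>x. \<bar>c\<bar> powr p * norm (h x) powr p)"
      using assms(3) by (simp add: Lp_space_def)
    show "(\<lambda>x. norm (f x) powr p) \<in> borel_measurable (lebesgue_on S)"
      using assms(2) by measurable
    show "AE x in lebesgue_on S. norm (norm (f x) powr p) \<le> norm (\<bar>c\<bar> powr p * norm (h x) powr p)"
    proof (rule AE_I2)
      fix x assume "x \<in> space (lebesgue_on S)"
      then have "norm (f x) powr p \<le> (\<bar>c\<bar> * norm (h x)) powr p"
        using assms(1) le by (intro powr_mono2) auto
      then show "norm (norm (f x) powr p) \<le> norm (\<bar>c\<bar> powr p * norm (h x) powr p)"
        by (simp add: powr_mult)
    qed
  qed
  then show ?thesis using assms(2) by (simp add: Lp_space_def)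
qed

lemma Lp_norm_dominated:
  assumes p: "0 < p" and c: "0 \<le> c" and h: "h \<in> Lp_space S p"
    and le: "\<And>x. x \<in> S \<Longrightarrow> norm (f x) \<le> c * norm (h x)"
  shows "Lp_norm S p f \<le> c * Lp_norm S p h"
proof -
  have "(\<integral>x. norm (f x) powr p \<partial>lebesgue_on S)
      \<le> (\<integral>x. c powr p * norm (h x) powr p \<partial>lebesgue_on S)"
  proof (rule integral_mono')
    show "integrable (lebesgue_on S) (\<lambda>x. c powr p * norm (h x) powr p)"
      using h by (simp add: Lp_space_def)
    fix x assume "x \<in> space (lebesgue_on S)"
    then have "norm (f x) powr p \<le> (c * norm (h x)) powr p"
      using p le by (intro powr_mono2) auto
    then show "norm (f x) powr p \<le> c powr p * norm (h x) powr p"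
      using c by (simp add: powr_mult)
  qed simp
  also have "\<dots> = (c * Lp_norm S p h) powr p"
    using p c by (simp add: Lp_norm_def powr_mult powr_powr)
  finally show ?thesis
    using p c by (simp add: Lp_norm_le_iff Lp_norm_nonneg)
qed

lemma Lp_loc_closure_measurable:
  assumes "open \<Omega>" and g: "g \<in> Lp_loc_closure \<Omega> p"
  shows "g \<in> borel_measurable (lebesgue_on \<Omega>)"
proof -
  have lm: "(\<lambda>x. if x \<in> \<Omega> \<inter> ball 0 (real m) then g x else 0) \<in> borel_measurable lebesgue" for m
    using g assms(1) by (subst borel_measurable_if) (auto simp: Lp_loc_closure_def Lp_space_def)
  have lim: "(\<lambda>m. if x \<in> \<Omega> \<inter> ball 0 (real m) then g x else 0) \<longlonglongrightarrow> (if x \<in> \<Omega> then g x else 0)" for x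
  proof (rule tendsto_eventually)
    obtain N where N: "norm x < real N" using reals_Archimedean2 by blast
    show "\<forall>\<^sub>F m in sequentially. (if x \<in> \<Omega> \<inter> ball 0 (real m) then g x else 0) = (if x \<in> \<Omega> then g x else 0)"
      using eventually_ge_at_top[of N] by eventually_elim (use N in \<open>auto simp: not_less\<close>)
  qed
  have "(\<lambda>x. if x \<in> \<Omega> then g x else 0) \<in> borel_measurable lebesgue"
    by (rule borel_measurable_LIMSEQ_metric[OF lm lim])
  then show ?thesis
    using assms(1) by (subst (asm) borel_measurable_if) auto
qed

lemma superlevel_set_measurable:
  assumes "open \<Omega>" and "g \<in> borel_measurable (lebesgue_on \<Omega>)"
  shows "superlevel_set \<Omega> g a \<in> sets lebesgue"
proof -
  have "{x \<in> space (lebesgue_on \<Omega>). a \<le> norm (g x)} \<in> sets (lebesgue_on \<Omega>)"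
    using assms(2) by measurable
  then show ?thesis
    using assms(1) by (simp add: sets_restrict_space_iff superlevel_set_def)
qed

lemma Lp_loc_closure_times_indicator:
  assumes "open \<Omega>" and "0 < q" and g: "g \<in> Lp_loc_closure \<Omega> q" and E: "E \<in> sets lebesgue"
  shows "(\<lambda>x. g x * indicator E x) \<in> Lp_loc_closure \<Omega> q"
proof -
  have "(\<lambda>x. g x * indicator E x) \<in> Lp_space (\<Omega> \<inter> ball y \<rho>) q" for y \<rho>
  proof (rule Lp_space_dominated)
    show gL: "g \<in> Lp_space (\<Omega> \<inter> ball y \<rho>) q" using g by (simp add: Lp_loc_closure_def)
    have "(indicator E :: _ \<Rightarrow> complex) \<in> borel_measurable (lebesgue_on (\<Omega> \<inter> ball y \<rho>))"
      using E by (intro measurable_restrict_space1 borel_measurable_indicator)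
    then show "(\<lambda>x. g x * indicator E x) \<in> borel_measurable (lebesgue_on (\<Omega> \<inter> ball y \<rho>))"
      using gL by (auto simp: Lp_space_def)
    show "norm (g x * indicator E x) \<le> 1 * norm (g x)" for x
      by (simp add: indicator_def)
  qed (use assms in simp)
  then show ?thesis by (simp add: Lp_loc_closure_def)
qed

theorem lemma4p4:
  fixes \<Omega> :: "(real ^ 'n) set" and d p q s C :: real and r :: nat
    and g :: "real ^ 'n \<Rightarrow> complex" and \<tau> rg :: "real \<Rightarrow> real"
  assumes "d > 0"
    and "open \<Omega>" and "cone_cond d \<Omega>"
    and "r \<ge> 1"
    and "1 \<le> p" and "p \<le> q"
    and "q \<ge> real CARD('n) / real r"
    and "real CARD('n) / real r = p \<Longrightarrow> p > 1 \<Longrightarrow> q > real CARD('n) / real r"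
    and "s \<le> p"
    and "g \<in> morrey_tilde_space d \<Omega> q (s / p)"
    and "is_mult_constant d \<Omega> r p q s C"
    and "is_modulus_of_continuity d \<Omega> q (s / p) g \<tau>"
    and "is_level_function d \<Omega> g rg"
  shows "\<forall>k>0. \<forall>u\<in>sobolev_space \<Omega> r p.
    Lp_norm \<Omega> p (\<lambda>x. g x * u x)
      \<le> C * \<tau> (1 / k) * sobolev_norm \<Omega> r p u + rg k * Lp_norm \<Omega> p u"
proof (intro allI impI ballI)
  fix k :: real and u assume k: "0 < k" and u: "u \<in> sobolev_space \<Omega> r p"
  define E where "E = superlevel_set \<Omega> g (rg k)"
  define f where "f = (\<lambda>x. g x * indicator E x)"
  define h where "h = (\<lambda>x. (g x * indicator (- E) x) * u x)"
  have gloc: "g \<in> Lp_loc_closure \<Omega> q"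
    using assms(10) by (simp add: morrey_tilde_space_def morrey_space_def)
  have gm: "g \<in> borel_measurable (lebesgue_on \<Omega>)"
    using assms(2) gloc by (rule Lp_loc_closure_measurable)
  have E: "E \<in> sets lebesgue"
    unfolding E_def using assms(2) gm by (rule superlevel_set_measurable)
  have uL: "u \<in> Lp_space \<Omega> p" using u by (simp add: sobolev_space_def)
  have rk: "0 < rg k" and small: "(SUP x\<in>\<Omega>. emeasure lebesgue (E \<inter> ball x d)) \<le> ennreal (1 / k)"
    using assms(13) k unfolding is_level_function_def E_def by blast+
  have "E \<subseteq> \<Omega>" by (auto simp: E_def superlevel_set_def)
  then have "morrey_enorm d \<Omega> q (s / p) f \<le> morrey_tau d \<Omega> q (s / p) g (1 / k)"
    unfolding morrey_tau_def f_def using E small by (intro SUP_upper) blast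
  also have "\<dots> \<le> ennreal (\<tau> (1 / k))"
    using assms(12) k by (simp add: is_modulus_of_continuity_def)
  finally have enorm: "morrey_enorm d \<Omega> q (s / p) f \<le> ennreal (\<tau> (1 / k))" .
  have \<tau>: "0 \<le> \<tau> (1 / k)"
    using assms(12) k by (simp add: is_modulus_of_continuity_def less_imp_le)
  have norm_f: "morrey_norm d \<Omega> q (s / p) f \<le> \<tau> (1 / k)"
    unfolding morrey_norm_def using enorm \<tau> by (rule enn2real_leI[rotated])
  have "f \<in> Lp_loc_closure \<Omega> q"
    unfolding f_def using assms gloc E by (intro Lp_loc_closure_times_indicator) auto
  then have fM: "f \<in> morrey_space d \<Omega> q (s / p)"
    using enorm by (auto simp: morrey_space_def intro: le_less_trans)
  have C: "0 \<le> C" and fu: "(\<lambda>x. f x * u x) \<in> Lp_space \<Omega> p"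
    and "Lp_norm \<Omega> p (\<lambda>x. f x * u x) \<le> C * morrey_norm d \<Omega> q (s / p) f * sobolev_norm \<Omega> r p u"
    using assms(11) fM u unfolding is_mult_constant_def by blast+
  note this(3)
  also have "C * morrey_norm d \<Omega> q (s / p) f * sobolev_norm \<Omega> r p u
      \<le> C * \<tau> (1 / k) * sobolev_norm \<Omega> r p u"
    using C norm_f by (intro mult_right_mono mult_left_mono) (auto simp: sobolev_norm_def)
  finally have near: "Lp_norm \<Omega> p (\<lambda>x. f x * u x) \<le> C * \<tau> (1 / k) * sobolev_norm \<Omega> r p u" .
  have hle: "norm (h x) \<le> rg k * norm (u x)" if "x \<in> \<Omega>" for x
    using that rk
    by (auto simp: h_def E_def superlevel_set_def indicator_def norm_mult intro!: mult_right_mono)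
  have "(indicator (- E) :: _ \<Rightarrow> complex) \<in> borel_measurable (lebesgue_on \<Omega>)"
    using Compl_in_sets_lebesgue[of E] E
    by (intro measurable_restrict_space1 borel_measurable_indicator) blast
  then have "h \<in> borel_measurable (lebesgue_on \<Omega>)"
    unfolding h_def using gm uL by (auto simp: Lp_space_def)
  then have hL: "h \<in> Lp_space \<Omega> p"
    using assms(5) uL hle by (intro Lp_space_dominated[of p h \<Omega> u "rg k"]) auto
  have far: "Lp_norm \<Omega> p h \<le> rg k * Lp_norm \<Omega> p u"
    using assms(5) rk uL hle by (intro Lp_norm_dominated) auto
  have "(\<lambda>x. g x * u x) = (\<lambda>x. f x * u x + h x)"
    by (auto simp: f_def h_def indicator_def)
  then have "Lp_norm \<Omega> p (\<lambda>x. g x * u x) \<le> Lp_norm \<Omega> p (\<lambda>x. f x * u x) + Lp_norm \<Omega> p h"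
    using Lp_norm_triangle[OF assms(5) fu hL] by simp
  then show "Lp_norm \<Omega> p (\<lambda>x. g x * u x)
      \<le> C * \<tau> (1 / k) * sobolev_norm \<Omega> r p u + rg k * Lp_norm \<Omega> p u"
    using near far by linarith
qed

end
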